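(* In both the neutral and the monocharge cases of the relativistic Vlasov-Maxwell system described in the context, there are no nontrivial steady solutions with $f^\alpha$ (for all $\alpha$), $E_2$ and $B$ compactly supported. That is, if $f^\alpha=f^\alpha(x,v)\ge0$ ($\alpha=1,\dots,N$), $E_2=E_2(x)$, $B=B(x)$ are $C^1$, compactly supported, and form a time-independent solution of the system in the neutral case or in the monocharge case, then all $f^\alpha$, $E_2$ and $B$ vanish identically.
   Context: The system, for $\alpha=1,\dots,N$, $t\ge0$, $x\in\mathbb{R}$, $v=(v_1,v_2)\in\mathbb{R}^2$, is $$\partial_t f^\alpha+\hat v_1^\alpha\partial_x f^\alpha+e^\alpha(E_1+\hat v_2^\alpha B)\partial_{v_1}f^\alpha+e^\alpha(E_2-\hat v_1^\alpha B)\partial_{v_2}f^\alpha=0,$$ $$\rho(t,x)=\int\sum_\alpha e^\alpha f^\alpha(t,x,v)\,dv,\qquad j(t,x)=\int\sum_\alpha e^\alpha f^\alpha(t,x,v)\hat v^\alpha\,dv,$$ $$E_1(t,x)=\tfrac12\int_{-\infty}^x\rho(t,y)\,dy-\tfrac12\int_x^\infty\rho(t,y)\,dy,\qquad \partial_tE_2+\partial_xB=-j_2,\qquad \partial_tB+\partial_xE_2=0,$$ where $\hat v^\alpha=v/\sqrt{(m^\alpha)^2+|v|^2}$, $m^\alpha>0$ is the mass and $e^\alpha\in\mathbb{R}$ the charge of species $\alpha$; $v$-integrals are over $\mathbb{R}^2$; the densities $f^\alpha$ are nonnegative. A steady solution is a solution independent of $t$. The neutral case means $\iint\sum_\alpha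 e^\alpha f^\alpha\,dv\,dx=0$ (at the initial time, hence at all times). The monocharge case means $N=1$, $e^1=1$, $m^1=1$. Note that $E_1$ is determined by $\rho$ via the formula above and is not assumed to be compactly supported. *)

theory Defs
  imports "HOL-Analysis.Analysis"
begin

text \<open>
  Relativistic Vlasov--Maxwell system with one space and two momentum dimensions. Species are
  indexed by \<open>\<alpha> \<in> {1..N}\<close>, with masses \<open>m \<alpha>\<close> and charges \<open>e \<alpha>\<close>. The densities at a fixed time are
  given by \<open>g \<alpha> x v\<close>; an evolution is \<open>f t \<alpha> x v\<close>. All integrals below are Lebesgue integrals.
  They are meaningful for integrable data, in particular for continuous compactly supported
  densities; for non-integrable data the library assigns them the value 0.
\<close>

type_synonym densities = "nat \<Rightarrow> real \<Rightarrow> real^2 \<Rightarrow> real"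

definition rel_velocity :: "real \<Rightarrow> real^2 \<Rightarrow> real^2" where
  "rel_velocity m v = v /\<^sub>R sqrt (m\<^sup>2 + (norm v)\<^sup>2)"

definition charge_density :: "nat \<Rightarrow> (nat \<Rightarrow> real) \<Rightarrow> densities \<Rightarrow> real \<Rightarrow> real" where
  "charge_density N e g x = (LINT v|lborel. (\<Sum>\<alpha>=1..N. e \<alpha> * g \<alpha> x v))"

definition current_density ::
  "nat \<Rightarrow> (nat \<Rightarrow> real) \<Rightarrow> (nat \<Rightarrow> real) \<Rightarrow> densities \<Rightarrow> real \<Rightarrow> real^2" where
  "current_density N m e g x =
     (LINT v|lborel. (\<Sum>\<alpha>=1..N. (e \<alpha> * g \<alpha> x v) *\<^sub>R rel_velocity (m \<alpha>) v))"

definition E1_field :: "nat \<Rightarrow> (nat \<Rightarrow> real) \<Rightarrow> densities \<Rightarrow> real \<Rightarrow> real" where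
  "E1_field N e g x =
     1/2 * (LINT y:{..x}|lborel. charge_density N e g y)
     - 1/2 * (LINT y:{x..}|lborel. charge_density N e g y)"

text \<open>
  Classical solutions: each partial derivative occurring in the equations exists and the equations
  hold at every \<open>t \<ge> 0\<close>; the time derivative at \<open>t = 0\<close> is one-sided.
\<close>

definition vlasov_equation ::
  "nat \<Rightarrow> (nat \<Rightarrow> real) \<Rightarrow> (nat \<Rightarrow> real) \<Rightarrow> (real \<Rightarrow> densities)
     \<Rightarrow> (real \<Rightarrow> real \<Rightarrow> real) \<Rightarrow> (real \<Rightarrow> real \<Rightarrow> real) \<Rightarrow> bool" where
  "vlasov_equation N m e f E2 B \<longleftrightarrow>
     (\<forall>\<alpha>\<in>{1..N}. \<forall>t\<ge>0. \<forall>x v. \<exists>ft fx fv1 fv2.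
        ((\<lambda>s. f s \<alpha> x v) has_real_derivative ft) (at t within {0..}) \<and>
        ((\<lambda>y. f t \<alpha> y v) has_real_derivative fx) (at x) \<and>
        ((\<lambda>h. f t \<alpha> x (v + h *\<^sub>R axis 1 1)) has_real_derivative fv1) (at 0) \<and>
        ((\<lambda>h. f t \<alpha> x (v + h *\<^sub>R axis 2 1)) has_real_derivative fv2) (at 0) \<and>
        ft + rel_velocity (m \<alpha>) v $ 1 * fx
           + e \<alpha> * (E1_field N e (f t) x + rel_velocity (m \<alpha>) v $ 2 * B t x) * fv1
           + e \<alpha> * (E2 t x - rel_velocity (m \<alpha>) v $ 1 * B t x) * fv2 = 0)"

definition maxwell_equations ::
  "nat \<Rightarrow> (nat \<Rightarrow> real) \<Rightarrow> (nat \<Rightarrow> real) \<Rightarrow> (real \<Rightarrow> densities)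
     \<Rightarrow> (real \<Rightarrow> real \<Rightarrow> real) \<Rightarrow> (real \<Rightarrow> real \<Rightarrow> real) \<Rightarrow> bool" where
  "maxwell_equations N m e f E2 B \<longleftrightarrow>
     (\<forall>t\<ge>0. \<forall>x. \<exists>E2t E2x Bt Bx.
        ((\<lambda>s. E2 s x) has_real_derivative E2t) (at t within {0..}) \<and>
        ((\<lambda>y. E2 t y) has_real_derivative E2x) (at x) \<and>
        ((\<lambda>s. B s x) has_real_derivative Bt) (at t within {0..}) \<and>
        ((\<lambda>y. B t y) has_real_derivative Bx) (at x) \<and>
        E2t + Bx = - (current_density N m e (f t) x $ 2) \<and>
        Bt + E2x = 0)"

definition RVM_solution ::
  "nat \<Rightarrow> (nat \<Rightarrow> real) \<Rightarrow> (nat \<Rightarrow> real) \<Rightarrow> (real \<Rightarrow> densities)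
     \<Rightarrow> (real \<Rightarrow> real \<Rightarrow> real) \<Rightarrow> (real \<Rightarrow> real \<Rightarrow> real) \<Rightarrow> bool" where
  "RVM_solution N m e f E2 B \<longleftrightarrow>
     vlasov_equation N m e f E2 B \<and> maxwell_equations N m e f E2 B"

definition steady_RVM_solution ::
  "nat \<Rightarrow> (nat \<Rightarrow> real) \<Rightarrow> (nat \<Rightarrow> real) \<Rightarrow> densities \<Rightarrow> (real \<Rightarrow> real) \<Rightarrow> (real \<Rightarrow> real) \<Rightarrow> bool"
where
  "steady_RVM_solution N m e g E2 B \<longleftrightarrow> RVM_solution N m e (\<lambda>t. g) (\<lambda>t. E2) (\<lambda>t. B)"

definition neutral :: "nat \<Rightarrow> (nat \<Rightarrow> real) \<Rightarrow> densities \<Rightarrow> bool" where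
  "neutral N e g \<longleftrightarrow> (LINT x|lborel. (LINT v|lborel. (\<Sum>\<alpha>=1..N. e \<alpha> * g \<alpha> x v))) = 0"

definition monocharge :: "nat \<Rightarrow> (nat \<Rightarrow> real) \<Rightarrow> (nat \<Rightarrow> real) \<Rightarrow> bool" where
  "monocharge N m e \<longleftrightarrow> N = 1 \<and> e 1 = 1 \<and> m 1 = 1"

definition C1_function :: "('a::real_normed_vector \<Rightarrow> 'b::real_normed_vector) \<Rightarrow> bool" where
  "C1_function F \<longleftrightarrow>
     (\<exists>F' :: 'a \<Rightarrow> 'a \<Rightarrow>\<^sub>L 'b.
        (\<forall>z. (F has_derivative blinfun_apply (F' z)) (at z)) \<and> continuous_on UNIV F')"

definition compactly_supported :: "('a::topological_space \<Rightarrow> 'b::zero) \<Rightarrow> bool" where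
  "compactly_supported F \<longleftrightarrow> compact (closure {z. F z \<noteq> 0})"

end

theory Submission
  imports Defs
begin

text \<open>
  Write \<open>\<rho>\<close> and \<open>j\<close> for the charge and current densities, \<open>M\<close> for the total charge, and
  \<open>P\<^sub>\<alpha> x = \<integral> v\<^sub>1 v\<^sub>1/\<gamma>\<^sub>\<alpha> f\<^sub>\<alpha> dv\<close>, with \<open>\<gamma>\<^sub>\<alpha> = sqrt (m\<^sub>\<alpha>\<^sup>2 + |v|\<^sup>2)\<close>, for the flux of \<open>v\<^sub>1\<close>-momentum
  carried by species \<open>\<alpha>\<close>. This flux is nonnegative and controls the density: if \<open>P\<^sub>\<alpha>\<close> vanishes at \<open>x\<close>, so does
  \<open>f\<^sub>\<alpha> x\<close> (\<open>momentum_flux_0_imp_0\<close>). It thus suffices to show that every \<open>P\<^sub>\<alpha>\<close> is zero; the current then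
  vanishes and the remaining field \<open>B\<close> is constant with compact support, as \<open>E2\<close> always is in a steady state.

  Multiplying the steady Vlasov equation by \<open>v\<^sub>1\<close> and integrating by parts in \<open>v\<close> says that the
  momentum flux changes at the rate of the force on the species (\<open>momentum_flux_has_derivative\<close>):
  \<open>P\<^sub>\<alpha>' = \<integral> e\<^sub>\<alpha> (E1 + v\<^sub>2/\<gamma>\<^sub>\<alpha> B) f\<^sub>\<alpha> dv\<close>.
  Summed over the species the right-hand side is \<open>E1 \<rho> + B j\<^sub>2 = E1 E1' - B B'\<close>, so that
  \<open>\<Sum>\<^sub>\<alpha> P\<^sub>\<alpha> - E1\<^sup>2/2 + B\<^sup>2/2\<close> does not depend on \<open>x\<close>. Left of all supports it is \<open>-M\<^sup>2/8\<close>, since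
  \<open>E1 = -M/2\<close> there. Hence \<open>\<Sum>\<^sub>\<alpha> P\<^sub>\<alpha> = E1\<^sup>2/2 - B\<^sup>2/2 - M\<^sup>2/8\<close> everywhere.

  In the monocharge case \<open>\<rho> \<ge> 0\<close> forces \<open>|E1| \<le> M/2\<close>, the right-hand side is nonpositive, and
  the nonnegative fluxes vanish.

  In the neutral case \<open>M = 0\<close>, so \<open>|B| \<le> |E1|\<close>, and no flux survives at a zero of \<open>E1\<close>. As
  particles are slower than light, the electric force dominates the magnetic one: wherever \<open>E1\<close>
  has a fixed sign, the force on species \<open>\<alpha>\<close> has the sign of \<open>e\<^sub>\<alpha> E1\<close>, and \<open>P\<^sub>\<alpha>\<close> is monotone. A
  monotone function that vanishes at both ends of an interval, here at two zeros of \<open>E1\<close>, vanishes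
  in between (\<open>vanishes_between_zeros\<close>). Such an interval surrounds every point because neutrality makes
  \<open>E1\<close> vanish near both infinities.
\<close>

section \<open>Integrals of compactly supported functions\<close>

lemma continuous_on_section:
  assumes "continuous_on UNIV (\<lambda>(x, v). G x v)" shows "continuous_on UNIV (G x)"
proof -
  have "continuous_on UNIV (\<lambda>v. case (x, v) of (x, v) \<Rightarrow> G x v)"
    by (rule continuous_on_compose2[OF assms]) (intro continuous_intros, simp)
  then show ?thesis by simp
qed

lemma integrable_lborel_bounded_support:
  fixes h :: "'a::euclidean_space \<Rightarrow> 'b::{banach, second_countable_topology}"
  assumes cont: "continuous_on UNIV h" and supp: "\<And>v. norm v > R \<Longrightarrow> h v = 0"
  shows "integrable lborel h"
proof -
  have eq: "(\<lambda>v. indicator (cball 0 R) v *\<^sub>R h v) = h"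
    using supp by (auto simp: fun_eq_iff indicator_def)
  have "integrable lborel (\<lambda>v. indicator (cball 0 R) v *\<^sub>R h v)"
    by (rule borel_integrable_compact) (auto intro: continuous_on_subset[OF cont])
  then show ?thesis unfolding eq .
qed

text \<open>The gauge integral over a box is where differentiation under the integral sign and the
  vanishing of nonnegative integrands are available.\<close>

lemma integral_lborel_eq_integral_cbox:
  fixes h :: "'a::euclidean_space \<Rightarrow> real"
  assumes cont: "continuous_on UNIV h" and supp: "\<And>v. v \<notin> cbox a b \<Longrightarrow> h v = 0"
  shows "(LINT v|lborel. h v) = integral (cbox a b) h"
proof -
  obtain R where R: "\<And>v. v \<in> cbox a b \<Longrightarrow> norm v \<le> R"
    using bounded_cbox[of a b] unfolding bounded_iff by blast
  then have "integrable lborel h"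
    using supp by (intro integrable_lborel_bounded_support[OF cont, of R]) (meson R not_le)
  then have "(h has_integral (LINT v|lborel. h v)) UNIV"
    by (rule has_integral_integral_lborel)
  moreover have "(\<lambda>v. if v \<in> cbox a b then h v else 0) = h"
    using supp by auto
  ultimately have "(h has_integral (LINT v|lborel. h v)) (cbox a b)"
    using has_integral_restrict_UNIV[of "cbox a b" h] by metis
  then show ?thesis
    by (simp add: integral_unique)
qed

text \<open>The Leibniz rule, transported to Lebesgue integrals over the whole space. The support need
  be uniformly bounded only for parameters near \<open>x0\<close>; this allows translates of a compactly
  supported function, whose supports drift off to infinity, in the next lemma.\<close>

lemma has_real_derivative_integral_lborel:
  fixes G G' :: "real \<Rightarrow> 'a::euclidean_space \<Rightarrow> real"
  assumes U: "open U" "convex U" "x0 \<in> U"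
    and deriv: "\<And>x v. x \<in> U \<Longrightarrow> ((\<lambda>x. G x v) has_real_derivative G' x v) (at x)"
    and cont: "\<And>x. x \<in> U \<Longrightarrow> continuous_on UNIV (G x)"
    and cont': "continuous_on UNIV (\<lambda>(x, v). G' x v)"
    and supp: "\<And>x v. x \<in> U \<Longrightarrow> norm v > R \<Longrightarrow> G x v = 0"
    and supp': "\<And>x v. x \<in> U \<Longrightarrow> norm v > R \<Longrightarrow> G' x v = 0"
  shows "((\<lambda>x. LINT v|lborel. G x v) has_real_derivative (LINT v|lborel. G' x0 v)) (at x0)"
proof -
  obtain a where "cball (0::'a) R \<subseteq> cbox (-a) a"
    using bounded_subset_cbox_symmetric[OF bounded_cball] by blast
  then have a: "norm v > R" if "v \<notin> cbox (-a) a" for v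
    using that by force
  have cG': "continuous_on UNIV (G' x)" for x
    using cont' by (rule continuous_on_section)
  have "((\<lambda>x. integral (cbox (-a) a) (G x)) has_real_derivative integral (cbox (-a) a) (G' x0))
    (at x0 within U)"
  proof (rule leibniz_rule_field_derivative)
    show "((\<lambda>x. G x t) has_real_derivative G' x t) (at x within U)" if "x \<in> U" for x t
      using deriv[OF that] by (rule has_field_derivative_at_within)
    show "G x integrable_on cbox (-a) a" if "x \<in> U" for x
      by (rule integrable_continuous) (rule continuous_on_subset[OF cont[OF that]], simp)
    show "continuous_on (U \<times> cbox (- a) a) (\<lambda>(x, t). G' x t)"
      using cont' by (rule continuous_on_subset) simp
  qed (use U in auto)
  then have "((\<lambda>x. integral (cbox (-a) a) (G x)) has_real_derivative integral (cbox (-a) a) (G' x0)) (at x0)"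
    by (simp only: at_within_open[OF U(3,1)])
  then have "((\<lambda>x. LINT v|lborel. G x v) has_real_derivative integral (cbox (-a) a) (G' x0)) (at x0)"
  proof (rule has_field_derivative_transform_within_open[OF _ U(1) U(3)])
    show "integral (cbox (-a) a) (G x) = (LINT v|lborel. G x v)" if "x \<in> U" for x
      by (rule integral_lborel_eq_integral_cbox[symmetric]) (use cont supp a that in auto)
  qed
  moreover have "(LINT v|lborel. G' x0 v) = integral (cbox (-a) a) (G' x0)"
    by (rule integral_lborel_eq_integral_cbox) (use cG' supp' U a in auto)
  ultimately show ?thesis by simp
qed

text \<open>By translation invariance \<open>\<integral> F (v + h u) dv\<close> is independent of \<open>h\<close>; now differentiate at
  \<open>h = 0\<close>. Applied to products this is integration by parts.\<close>

lemma integral_directional_derivative_eq_0: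
  fixes F F' :: "'a::euclidean_space \<Rightarrow> real"
  assumes deriv: "\<And>v. ((\<lambda>h. F (v + h *\<^sub>R u)) has_real_derivative F' v) (at 0)"
    and cont: "continuous_on UNIV F" and cont': "continuous_on UNIV F'"
    and supp: "\<And>v. norm v > R \<Longrightarrow> F v = 0" and supp': "\<And>v. norm v > R \<Longrightarrow> F' v = 0"
  shows "(LINT v|lborel. F' v) = 0"
proof -
  \<comment> \<open>All translates with \<open>|h| < 1\<close> live in the ball of radius \<open>R + |u|\<close>.\<close>
  have far: "norm (v + h *\<^sub>R u) > R" if "h \<in> {-1<..<1}" "norm v > R + norm u" for v h
  proof -
    have "\<bar>h\<bar> * norm u \<le> 1 * norm u"
      using that by (intro mult_right_mono) auto
    moreover have "norm v \<le> norm (v + h *\<^sub>R u) + norm (h *\<^sub>R u)"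
      using norm_triangle_ineq4[of "v + h *\<^sub>R u" "h *\<^sub>R u"] by simp
    ultimately show ?thesis
      using that by simp
  qed
  have "((\<lambda>h. LINT v|lborel. F (v + h *\<^sub>R u)) has_real_derivative (LINT v|lborel. F' (v + 0 *\<^sub>R u))) (at 0)"
  proof (rule has_real_derivative_integral_lborel[where U="{-1<..<1}" and R="R + norm u"])
    show "((\<lambda>h. F (v + h *\<^sub>R u)) has_real_derivative F' (v + h *\<^sub>R u)) (at h)" for v h
      using deriv[of "v + h *\<^sub>R u"] DERIV_shift[of "\<lambda>h. F (v + h *\<^sub>R u)" "F' (v + h *\<^sub>R u)" 0 h]
      by (simp add: algebra_simps)
    show "continuous_on UNIV (\<lambda>v. F (v + h *\<^sub>R u))" for h
      by (rule continuous_on_compose2[OF cont]) (auto intro: continuous_intros)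
    have "continuous_on UNIV (\<lambda>z. F' (snd z + fst z *\<^sub>R u))"
      by (rule continuous_on_compose2[OF cont']) (auto intro!: continuous_intros)
    then show "continuous_on UNIV (\<lambda>(h, v). F' (v + h *\<^sub>R u))"
      by (simp add: case_prod_unfold)
  qed (use far supp supp' in auto)
  moreover have "(LINT v|lborel. F (v + h *\<^sub>R u)) = (LINT v|lborel. F v)" for h
  proof -
    have [measurable]: "F \<in> borel_measurable borel"
      using cont by (rule borel_measurable_continuous_onI)
    have "(LINT v|lborel. F v) = (LINT v|distr lborel borel ((+) (h *\<^sub>R u)). F v)"
      by (simp only: lborel_distr_plus)
    also have "\<dots> = (LINT v|lborel. F (h *\<^sub>R u + v))"
      by (rule integral_distr) auto
    finally show ?thesis by (simp add: add.commute)
  qed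
  ultimately have "((\<lambda>h. LINT v|lborel. F v) has_real_derivative (LINT v|lborel. F' v)) (at 0)"
    by simp
  then show ?thesis
    using DERIV_unique DERIV_const by blast
qed

lemma nonneg_continuous_integral_0_imp_0:
  fixes h :: "'a::euclidean_space \<Rightarrow> real"
  assumes cont: "continuous_on UNIV h" and supp: "\<And>v. norm v > R \<Longrightarrow> h v = 0"
    and nonneg: "\<And>v. h v \<ge> 0" and int: "(LINT v|lborel. h v) = 0"
  shows "h v = 0"
proof -
  \<comment> \<open>The box must contain the support and the point \<open>v\<close>, and have nonempty interior.\<close>
  obtain a where a: "cball (0::'a) (max R (norm v) + 1) \<subseteq> cbox (-a) a"
    using bounded_subset_cbox_symmetric[OF bounded_cball] by blast
  have far: "h w = 0" if "w \<notin> cbox (-a) a" for w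
    using a that by (intro supp) force
  have "integral (cbox (-a) a) h = 0"
    using integral_lborel_eq_integral_cbox[OF cont far] int by simp
  moreover have "h integrable_on cbox (-a) a"
    by (rule integrable_continuous) (rule continuous_on_subset[OF cont], simp)
  ultimately have "(h has_integral 0) (cbox (-a) a)"
    using has_integral_integral by metis
  moreover have "box (-a) a \<noteq> {}"
  proof -
    have "ball (0::'a) (max R (norm v) + 1) \<subseteq> interior (cbox (-a) a)"
      using a by (intro interior_maximal) (auto intro: subset_trans[OF ball_subset_cball])
    then have "0 \<in> box (-a) a"
      unfolding interior_cbox by (smt (verit) centre_in_ball in_mono norm_ge_zero)
    then show ?thesis by blast
  qed
  moreover have "v \<in> cbox (-a) a"
    using a by auto
  ultimately show ?thesis
    using has_integral_0_cbox_imp_0[of "-a" a h v] nonneg continuous_on_subset[OF cont] by blast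
qed

section \<open>The electric field\<close>

text \<open>The two half-line integrals add up to \<open>M\<close>, so \<open>E\<close> is, up to the constant \<open>M / 2\<close>, either one
  of them: it is a primitive of \<open>\<rho>\<close>, takes the values \<open>- M / 2\<close> and \<open>M / 2\<close> outside the support,
  and stays between them when \<open>\<rho>\<close> is nonnegative.\<close>

lemma half_line_difference:
  fixes \<rho> E :: "real \<Rightarrow> real" and M :: real
  assumes cont: "continuous_on UNIV \<rho>" and supp: "\<And>y. \<bar>y\<bar> > R \<Longrightarrow> \<rho> y = 0"
    and E_def: "\<And>x. E x = 1/2 * (LINT y:{..x}|lborel. \<rho> y) - 1/2 * (LINT y:{x..}|lborel. \<rho> y)"
    and M_def: "M = (LINT y|lborel. \<rho> y)"
  shows "(E has_real_derivative \<rho> x) (at x)"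
    and "x < -R \<Longrightarrow> E x = - M / 2"
    and "x > R \<Longrightarrow> E x = M / 2"
    and "(\<And>y. \<rho> y \<ge> 0) \<Longrightarrow> \<bar>E x\<bar> \<le> M / 2"
proof -
  have int: "integrable lborel \<rho>"
    using cont supp by (intro integrable_lborel_bounded_support[where R=R]) auto
  then have sint: "set_integrable lborel A \<rho>" if "A \<in> sets borel" for A
    using that unfolding set_integrable_def by (intro integrable_mult_indicator int) simp
  have split: "(LINT y:{..x}|lborel. \<rho> y) + (LINT y:{x..}|lborel. \<rho> y) = M" for x
  proof -
    have "(LINT y:{x..}|lborel. \<rho> y) = (LINT y:{x<..}|lborel. \<rho> y)"
      unfolding set_lebesgue_integral_def
    proof (rule integral_cong_AE)
      show "AE y in lborel. indicator {x..} y *\<^sub>R \<rho> y = indicator {x<..} y *\<^sub>R \<rho> y"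
        using AE_lborel_singleton[of x] by eventually_elim (auto simp: indicator_def)
    qed (use borel_measurable_integrable[OF int] in auto)
    moreover have "(LINT y:{..x} \<union> {x<..}|lborel. \<rho> y)
        = (LINT y:{..x}|lborel. \<rho> y) + (LINT y:{x<..}|lborel. \<rho> y)"
      by (rule set_integral_Un) (auto intro: sint)
    moreover have "{..x} \<union> {x<..} = UNIV" by auto
    ultimately show ?thesis by (simp add: M_def set_lebesgue_integral_def)
  qed
  have E: "E x = (LINT y:{..x}|lborel. \<rho> y) - M / 2"
    "E x = M / 2 - (LINT y:{x..}|lborel. \<rho> y)" for x
    using split[of x] by (simp_all add: E_def field_simps)
  show "x < -R \<Longrightarrow> E x = - M / 2" 
  proof -
    assume far: "x < -R"
    have "(LINT y:{..x}|lborel. \<rho> y) = (LINT y::real|lborel. 0)"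
      unfolding set_lebesgue_integral_def
      by (rule Bochner_Integration.integral_cong) (use supp far in \<open>auto simp: indicator_def\<close>)
    then show ?thesis by (simp add: E(1))
  qed
  show "x > R \<Longrightarrow> E x = M / 2" 
  proof -
    assume far: "x > R"
    have "(LINT y:{x..}|lborel. \<rho> y) = (LINT y::real|lborel. 0)"
      unfolding set_lebesgue_integral_def
      by (rule Bochner_Integration.integral_cong) (use supp far in \<open>auto simp: indicator_def\<close>)
    then show ?thesis by (simp add: E(2))
  qed
  show "\<bar>E x\<bar> \<le> M / 2" if "\<And>y. \<rho> y \<ge> 0"
  proof -
    have "(LINT y:{..x}|lborel. \<rho> y) \<ge> 0" "(LINT y:{x..}|lborel. \<rho> y) \<ge> 0"
      using that by (auto simp: set_lebesgue_integral_def)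
    then show ?thesis using E[of x] by linarith
  qed
  \<comment> \<open>A starting point left of the support and of \<open>x\<close> turns the half-line integral into one over
    a compact interval.\<close>
  define a where "a = min x (-R) - 1"
  define b where "b = x + 1"
  have ab: "x \<in> {a<..<b}" by (auto simp: a_def b_def)
  have "((\<lambda>u. integral {a..u} \<rho>) has_real_derivative \<rho> x) (at x within {a..b})"
    by (rule integral_has_real_derivative) (use ab in \<open>auto intro: continuous_on_subset[OF cont]\<close>)
  then have "((\<lambda>u. integral {a..u} \<rho>) has_real_derivative \<rho> x) (at x)"
    using ab by (subst (asm) at_within_interior) auto
  then have "((\<lambda>u. integral {a..u} \<rho> - M / 2) has_real_derivative \<rho> x) (at x)"
    by (auto intro!: derivative_eq_intros)
  moreover have "integral {a..u} \<rho> - M / 2 = E u" if "u \<in> {a<..<b}" for u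
  proof -
    have "(LINT y:{..u}|lborel. \<rho> y) = (LINT y:{a..u}|lborel. \<rho> y)"
      unfolding set_lebesgue_integral_def
      by (rule Bochner_Integration.integral_cong) (use supp in \<open>auto simp: indicator_def a_def\<close>)
    also have "\<dots> = integral {a..u} \<rho>"
      by (rule set_borel_integral_eq_integral(2)) (auto intro: sint)
    finally show ?thesis by (simp add: E)
  qed
  ultimately show "(E has_real_derivative \<rho> x) (at x)"
    by (rule has_field_derivative_transform_within_open[OF _ open_greaterThanLessThan ab])
qed

section \<open>Monotonicity between zeros\<close>

text \<open>Up to the first zero \<open>b\<close> of \<open>E\<close> to the right of \<open>x0\<close> the sign of \<open>c * E\<close> persists, so \<open>P\<close>
  increases there; but \<open>P b = 0\<close> and \<open>P\<close> is nonnegative. The number \<open>c\<close> will be a charge, possibly zero.\<close>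

lemma vanishes_by_next_zero:
  fixes P D E :: "real \<Rightarrow> real"
  assumes deriv: "\<And>x. (P has_real_derivative D x) (at x)"
    and cont: "continuous_on UNIV E"
    and nonneg: "\<And>x. P x \<ge> 0"
    and zero: "\<And>x. E x = 0 \<Longrightarrow> P x = 0"
    and incr: "\<And>x. 0 \<le> c * E x \<Longrightarrow> 0 \<le> D x"
    and x0: "0 \<le> c * E x0" and r: "x0 \<le> r" "E r = 0"
  shows "P x0 = 0"
proof -
  define S where "S = {x0..r} \<inter> E -` {0}"
  have "closed (E -` {0})"
    using continuous_closed_vimage[OF closed_singleton] cont continuous_on_eq_continuous_at open_UNIV
    by blast
  then have "compact S" unfolding S_def
    by (rule compact_Int_closed[OF compact_Icc])
  moreover have "S \<noteq> {}" using r by (auto simp: S_def)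
  ultimately obtain b where b: "b \<in> S" "\<And>y. y \<in> S \<Longrightarrow> b \<le> y"
    using compact_attains_inf by metis
  have sign: "0 \<le> c * E x" if x: "x0 \<le> x" "x \<le> b" for x
  proof (rule ccontr)
    assume neg: "\<not> 0 \<le> c * E x"
    have "\<exists>y. x0 \<le> y \<and> y \<le> x \<and> c * E y = 0"
      by (rule IVT2') (use neg x0 x in \<open>auto intro!: continuous_intros continuous_on_subset[OF cont]\<close>)
    then obtain y where y: "x0 \<le> y" "y \<le> x" "c * E y = 0" by blast
    then have "y \<in> S" using neg x b(1) by (auto simp: S_def)
    then have "y = x" using b(2) y x by force
    then show False using y neg by auto
  qed
  have "P x0 \<le> P b"
    using b(1) deriv incr sign by (intro DERIV_nonneg_imp_nondecreasing[of x0 b P]) (auto simp: S_def)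
  also have "P b = 0" using b(1) zero by (auto simp: S_def)
  finally show ?thesis using nonneg[of x0] by simp
qed

text \<open>If \<open>c * E x\<close> is negative, \<open>P\<close> decreases from the last zero of \<open>E\<close> to the left of \<open>x\<close>. This is
  the previous lemma after the reflection \<open>x \<mapsto> - x\<close>, which reverses the sign of the derivative
  and is compensated by passing from \<open>c\<close> to \<open>- c\<close>.\<close>

lemma vanishes_between_zeros:
  fixes P D E :: "real \<Rightarrow> real"
  assumes deriv: "\<And>x. (P has_real_derivative D x) (at x)"
    and cont: "continuous_on UNIV E"
    and nonneg: "\<And>x. P x \<ge> 0"
    and zero: "\<And>x. E x = 0 \<Longrightarrow> P x = 0"
    and incr: "\<And>x. 0 \<le> c * E x \<Longrightarrow> 0 \<le> D x"
    and decr: "\<And>x. c * E x \<le> 0 \<Longrightarrow> D x \<le> 0"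
    and lr: "l \<le> x" "E l = 0" "x \<le> r" "E r = 0"
  shows "P x = 0"
proof (cases "0 \<le> c * E x")
  case True
  then show ?thesis
    using vanishes_by_next_zero[OF deriv cont nonneg zero incr] lr by blast
next
  case False
  have "P (- (- x)) = 0"
  proof (rule vanishes_by_next_zero[where P="\<lambda>x. P (- x)" and D="\<lambda>x. - D (- x)"
        and E="\<lambda>x. E (- x)" and c="- c" and r="- l"])
    show "((\<lambda>x. P (- x)) has_real_derivative - D (- y)) (at y)" for y
      using deriv by (simp flip: DERIV_mirror)
    show "continuous_on UNIV (\<lambda>x. E (- x))"
      by (rule continuous_on_compose2[OF cont]) (auto intro: continuous_intros)
  qed (use nonneg zero decr False lr in auto)
  then show ?thesis by simp
qed

section \<open>Partial derivatives of a phase space density\<close>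

lemma C1_imp_continuous_on:
  assumes "C1_function F" shows "continuous_on UNIV F"
proof -
  have "isCont F z" for z
    using assms has_derivative_continuous unfolding C1_function_def by blast
  then show ?thesis by (simp add: continuous_at_imp_continuous_on)
qed

lemma C1_partial_derivatives:
  fixes g :: "real \<Rightarrow> real^2 \<Rightarrow> real"
  assumes C1: "C1_function (\<lambda>(x, v). g x v)" and supp: "\<And>x v. norm v > R \<Longrightarrow> g x v = 0"
  obtains gx and gv :: "2 \<Rightarrow> real \<Rightarrow> real^2 \<Rightarrow> real" where
    "\<And>x v. ((\<lambda>y. g y v) has_real_derivative gx x v) (at x)"
    "\<And>i x v. ((\<lambda>h. g x (v + h *\<^sub>R axis i 1)) has_real_derivative gv i x v) (at 0)"
    "continuous_on UNIV (\<lambda>(x, v). gx x v)"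
    "\<And>i. continuous_on UNIV (\<lambda>(x, v). gv i x v)"
    "\<And>x v. norm v > R \<Longrightarrow> gx x v = 0"
    "\<And>i x v. norm v > R \<Longrightarrow> gv i x v = 0"
proof -
  obtain F' :: "real \<times> (real^2) \<Rightarrow> (real \<times> (real^2)) \<Rightarrow>\<^sub>L real"
    where F': "\<And>z. ((\<lambda>(x, v). g x v) has_derivative blinfun_apply (F' z)) (at z)"
      and cF': "continuous_on UNIV F'"
    using C1 unfolding C1_function_def by blast
  define gx where "gx = (\<lambda>x v. blinfun_apply (F' (x, v)) (1, 0))"
  define gv where "gv = (\<lambda>(i::2) x v. blinfun_apply (F' (x, v)) (0, axis i 1))"
  have line: "((\<lambda>h. g (x + h * a) (v + h *\<^sub>R w)) has_real_derivative blinfun_apply (F' (x, v)) (a, w)) (at 0)"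
    for x a v w
  proof -
    have "((\<lambda>h. (x + h * a, v + h *\<^sub>R w)) has_derivative (\<lambda>h. (h * a, h *\<^sub>R w))) (at 0)"
      by (auto intro!: derivative_eq_intros)
    from has_derivative_compose[OF this, of "\<lambda>(x, v). g x v" "blinfun_apply (F' (x, v))"] F'
    have "((\<lambda>h. g (x + h * a) (v + h *\<^sub>R w)) has_derivative (\<lambda>h. blinfun_apply (F' (x, v)) (h * a, h *\<^sub>R w))) (at 0)"
      by simp
    moreover have "blinfun_apply (F' (x, v)) (h * a, h *\<^sub>R w) = h * blinfun_apply (F' (x, v)) (a, w)" for h
      using blinfun.scaleR_right[of "F' (x, v)" h "(a, w)"] by simp
    moreover have "(\<lambda>h. h * blinfun_apply (F' (x, v)) (a, w)) = (*) (blinfun_apply (F' (x, v)) (a, w))"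
      by (simp add: fun_eq_iff)
    ultimately show ?thesis
      by (simp only: has_field_derivative_def)
  qed
  have zero: "F' (x, v) = 0" if "norm v > R" for x v
  proof -
    have op: "open (UNIV \<times> {v::real^2. norm v > R})"
      by (intro open_Times open_UNIV open_Collect_less continuous_intros)
    have "((\<lambda>_. 0) has_derivative blinfun_apply (F' (x, v))) (at (x, v))"
      using F'[of "(x, v)"] by (rule has_derivative_transform_within_open[OF _ op])
        (use that supp in auto)
    then have "blinfun_apply (F' (x, v)) = (\<lambda>_. 0)"
      using has_derivative_unique has_derivative_const by blast
    then show ?thesis by (intro blinfun_eqI) simp
  qed
  show ?thesis
  proof (rule that[of gx gv])
    show "((\<lambda>y. g y v) has_real_derivative gx x v) (at x)" for x v
      using line[of x 1 v 0] DERIV_shift[of "\<lambda>y. g y v" "gx x v" 0 x]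
      by (simp add: gx_def add.commute)
    show "((\<lambda>h. g x (v + h *\<^sub>R axis i 1)) has_real_derivative gv i x v) (at 0)" for i x v
      using line[of x 0 v "axis i 1"] by (simp add: gv_def)
    show "continuous_on UNIV (\<lambda>(x, v). gx x v)" "continuous_on UNIV (\<lambda>(x, v). gv i x v)" for i
      unfolding gx_def gv_def case_prod_unfold using cF' by (auto intro!: continuous_intros)
  qed (auto simp: gx_def gv_def zero)
qed

section \<open>The relativistic velocity\<close>

lemma rel_velocity_nth: "rel_velocity m v $ i = v $ i / sqrt (m\<^sup>2 + (v $ 1)\<^sup>2 + (v $ 2)\<^sup>2)"
  by (simp add: rel_velocity_def norm_vec_def L2_set_def UNIV_2 divide_inverse mult.commute add.assoc)

lemma energy_pos:
  fixes m p q :: real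
  assumes "m > 0" shows "m\<^sup>2 + p\<^sup>2 + q\<^sup>2 > 0"
  using assms by (simp add: add_pos_nonneg)

lemma continuous_on_rel_velocity:
  assumes "m > 0" shows "continuous_on S (rel_velocity m)"
proof -
  have "m\<^sup>2 + (norm v)\<^sup>2 \<noteq> 0" for v :: "real^2"
    using assms by (simp add: add_pos_nonneg less_imp_neq[THEN not_sym])
  then show ?thesis
    unfolding rel_velocity_def by (intro continuous_intros) simp_all
qed

lemma abs_rel_velocity_le_1:
  assumes "m > 0" shows "\<bar>rel_velocity m v $ i\<bar> \<le> 1"
proof -
  have "norm v \<le> sqrt (m\<^sup>2 + (norm v)\<^sup>2)"
    by (rule real_le_rsqrt) simp
  moreover have "sqrt (m\<^sup>2 + (norm v)\<^sup>2) > 0"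
    using assms by (simp add: add_pos_nonneg)
  ultimately have "norm (rel_velocity m v) \<le> 1"
    by (simp add: rel_velocity_def field_simps)
  then show ?thesis
    using component_le_norm_cart[of "rel_velocity m v" i] by linarith
qed

lemma has_real_derivative_divide_sqrt:
  fixes p q c :: real
  assumes "c + p\<^sup>2 > 0"
  shows "((\<lambda>h. q / sqrt (c + (p + h)\<^sup>2)) has_real_derivative - p * q / sqrt (c + p\<^sup>2) ^ 3) (at 0)"
proof -
  define s where "s = sqrt (c + p\<^sup>2)"
  have "s > 0" using assms by (simp add: s_def)
  have "((\<lambda>h. sqrt (c + (p + h)\<^sup>2)) has_real_derivative p / s) (at 0)"
    using assms by (auto intro!: derivative_eq_intros simp: s_def field_simps)
  from DERIV_divide[OF DERIV_const[of q] this]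
  have "((\<lambda>h. q / sqrt (c + (p + h)\<^sup>2)) has_real_derivative - (q * (p / s)) / (s * s)) (at 0)"
    using \<open>s > 0\<close> by (simp add: s_def)
  moreover have "- (q * (p / s)) / (s * s) = - p * q / s ^ 3"
    using \<open>s > 0\<close> by (simp add: field_simps power3_eq_cube)
  ultimately show ?thesis by (simp only: s_def)
qed

text \<open>The velocity is the gradient of the energy \<open>sqrt (m\<^sup>2 + |v|\<^sup>2)\<close>, so its Jacobian is symmetric.
  This is why the magnetic force is divergence free in \<open>v\<close>: the two cross terms cancel.\<close>

lemma rel_velocity_cross_derivatives:
  fixes v :: "real^2"
  assumes "m > 0"
  defines "k \<equiv> - v $ 1 * v $ 2 / sqrt (m\<^sup>2 + (v $ 1)\<^sup>2 + (v $ 2)\<^sup>2) ^ 3"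
  shows "((\<lambda>h. rel_velocity m (v + h *\<^sub>R axis 1 1) $ 2) has_real_derivative k) (at 0)"
    and "((\<lambda>h. rel_velocity m (v + h *\<^sub>R axis 2 1) $ 1) has_real_derivative k) (at 0)"
proof -
  note pos = energy_pos[OF assms(1), of "v $ 1" "v $ 2"]
  show "((\<lambda>h. rel_velocity m (v + h *\<^sub>R axis 1 1) $ 2) has_real_derivative k) (at 0)"
    "((\<lambda>h. rel_velocity m (v + h *\<^sub>R axis 2 1) $ 1) has_real_derivative k) (at 0)"
    unfolding rel_velocity_nth k_def
    using has_real_derivative_divide_sqrt[of "m\<^sup>2 + (v $ 2)\<^sup>2" "v $ 1" "v $ 2"]
      has_real_derivative_divide_sqrt[of "m\<^sup>2 + (v $ 1)\<^sup>2" "v $ 2" "v $ 1"] pos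
    by (simp_all add: axis_def add.commute add.left_commute mult.commute)
qed

section \<open>The balance of momentum\<close>

text \<open>Here \<open>a\<close> and \<open>b\<close> stand for the values of \<open>E1\<close> and \<open>B\<close> at the point \<open>x\<close>. By the Vlasov equation
  \<open>v\<^sub>1 v\<^sub>1/\<gamma> \<partial>\<^sub>xg\<close> is \<open>e (a + v\<^sub>2/\<gamma> b) g\<close> up to a divergence in \<open>v\<close>, namely \<open>e (\<partial>\<^sub>1 F1 - \<partial>\<^sub>2 F2)\<close> with \<open>F1\<close> and \<open>F2\<close>
  as in the proof, and divergences integrate to zero.\<close>

lemma momentum_flux_has_derivative:
  fixes g :: "real \<Rightarrow> real^2 \<Rightarrow> real"
  assumes m: "m > 0"
    and C1: "C1_function (\<lambda>(x, v). g x v)" and supp: "\<And>x v. norm v > R \<Longrightarrow> g x v = 0"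
    and vlasov: "\<And>v. \<exists>fx fv1 fv2.
        ((\<lambda>y. g y v) has_real_derivative fx) (at x) \<and>
        ((\<lambda>h. g x (v + h *\<^sub>R axis 1 1)) has_real_derivative fv1) (at 0) \<and>
        ((\<lambda>h. g x (v + h *\<^sub>R axis 2 1)) has_real_derivative fv2) (at 0) \<and>
        rel_velocity m v $ 1 * fx + e * (a + rel_velocity m v $ 2 * b) * fv1
          - e * (rel_velocity m v $ 1 * b) * fv2 = 0"
  shows "((\<lambda>x. LINT v|lborel. v $ 1 * rel_velocity m v $ 1 * g x v) has_real_derivative
     (LINT v|lborel. e * (a + rel_velocity m v $ 2 * b) * g x v)) (at x)"
proof -
  obtain gx gv where
    dx: "\<And>x v. ((\<lambda>y. g y v) has_real_derivative gx x v) (at x)" and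
    dv: "\<And>i x v. ((\<lambda>h. g x (v + h *\<^sub>R axis i 1)) has_real_derivative gv i x v) (at 0)" and
    cx: "continuous_on UNIV (\<lambda>(x, v). gx x v)" and
    cv: "\<And>i. continuous_on UNIV (\<lambda>(x, v). gv i x v)" and
    sx: "\<And>x v. norm v > R \<Longrightarrow> gx x v = 0" and
    sv: "\<And>i x v. norm v > R \<Longrightarrow> gv i x v = 0"
    by (rule C1_partial_derivatives[of g R, OF C1]) (rule supp, assumption, rule that)
  have eq: "rel_velocity m v $ 1 * gx x v + e * (a + rel_velocity m v $ 2 * b) * gv 1 x v
      - e * (rel_velocity m v $ 1 * b) * gv 2 x v = 0" for v
  proof -
    obtain fx fv1 fv2 where
      f: "((\<lambda>y. g y v) has_real_derivative fx) (at x)"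
        "((\<lambda>h. g x (v + h *\<^sub>R axis 1 1)) has_real_derivative fv1) (at 0)"
        "((\<lambda>h. g x (v + h *\<^sub>R axis 2 1)) has_real_derivative fv2) (at 0)"
      and eq: "rel_velocity m v $ 1 * fx + e * (a + rel_velocity m v $ 2 * b) * fv1
          - e * (rel_velocity m v $ 1 * b) * fv2 = 0"
      using vlasov[of v] by blast
    show ?thesis
      using eq DERIV_unique[OF f(1) dx] DERIV_unique[OF f(2) dv] DERIV_unique[OF f(3) dv] by simp
  qed
  have cg: "continuous_on UNIV (g y)" for y
    by (rule continuous_on_section[OF C1_imp_continuous_on[OF C1]])
  have cgv: "continuous_on UNIV (gv i x)" for i
    using cv by (rule continuous_on_section)
  have cgx: "continuous_on UNIV (gx x)"
    using cx by (rule continuous_on_section)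
  define k where "k = (\<lambda>v::real^2. - v $ 1 * v $ 2 / sqrt (m\<^sup>2 + (v $ 1)\<^sup>2 + (v $ 2)\<^sup>2) ^ 3)"
  have ck: "continuous_on UNIV k"
    unfolding k_def using energy_pos[OF m]
    by (auto intro!: continuous_intros simp: less_imp_neq[THEN not_sym])
  have cr: "continuous_on UNIV (\<lambda>v. rel_velocity m v $ i)" for i
    by (intro continuous_intros continuous_on_rel_velocity m)
  note cont = cg cgv cgx ck cr
  define F1 where "F1 = (\<lambda>v. v $ 1 * (a + rel_velocity m v $ 2 * b) * g x v)"
  define F1' where "F1' = (\<lambda>v. (a + rel_velocity m v $ 2 * b) * g x v + v $ 1 * (k v * b) * g x v
      + v $ 1 * (a + rel_velocity m v $ 2 * b) * gv 1 x v)"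
  define F2 where "F2 = (\<lambda>v. v $ 1 * (rel_velocity m v $ 1 * b) * g x v)"
  define F2' where "F2' = (\<lambda>v. v $ 1 * (k v * b) * g x v
      + v $ 1 * (rel_velocity m v $ 1 * b) * gv 2 x v)"
  have c': "continuous_on UNIV F1'" "continuous_on UNIV F2'"
    unfolding F1'_def F2'_def by (intro continuous_intros cont)+
  have s': "F1' v = 0" "F2' v = 0" if "norm v > R" for v
    using that by (simp_all add: F1'_def F2'_def supp sv)
  have I1: "(LINT v|lborel. F1' v) = 0"
  proof (rule integral_directional_derivative_eq_0[of F1 "axis 1 1" F1' R])
    show "((\<lambda>h. F1 (v + h *\<^sub>R axis 1 1)) has_real_derivative F1' v) (at 0)" for v
    proof -
      have d: "((\<lambda>h. (v + h *\<^sub>R axis 1 1) $ 1) has_real_derivative 1) (at 0)"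
        by (auto intro!: derivative_eq_intros simp: axis_def)
      have r: "((\<lambda>h. rel_velocity m (v + h *\<^sub>R axis 1 1) $ 2) has_real_derivative k v) (at 0)"
        unfolding k_def using m by (rule rel_velocity_cross_derivatives(1))
      show ?thesis
        unfolding F1_def F1'_def
        by (rule DERIV_cong[OF DERIV_mult[OF DERIV_mult[OF d DERIV_add[OF DERIV_const DERIV_cmult_right[OF r]]] dv]])
          (simp add: algebra_simps)
    qed
    show "continuous_on UNIV F1" unfolding F1_def by (intro continuous_intros cont)
  qed (use c' s' supp F1_def in auto)
  have I2: "(LINT v|lborel. F2' v) = 0"
  proof (rule integral_directional_derivative_eq_0[of F2 "axis 2 1" F2' R])
    show "((\<lambda>h. F2 (v + h *\<^sub>R axis 2 1)) has_real_derivative F2' v) (at 0)" for v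
    proof -
      have d: "((\<lambda>h. (v + h *\<^sub>R axis 2 1) $ 1) has_real_derivative 0) (at 0)"
        by (auto intro!: derivative_eq_intros simp: axis_def)
      have r: "((\<lambda>h. rel_velocity m (v + h *\<^sub>R axis 2 1) $ 1) has_real_derivative k v) (at 0)"
        unfolding k_def using m by (rule rel_velocity_cross_derivatives(2))
      show ?thesis
        unfolding F2_def F2'_def
        by (rule DERIV_cong[OF DERIV_mult[OF DERIV_mult[OF d DERIV_cmult_right[OF r]] dv]])
          (simp add: algebra_simps)
    qed
    show "continuous_on UNIV F2" unfolding F2_def by (intro continuous_intros cont)
  qed (use c' s' supp F2_def in auto)
  have int: "integrable lborel F1'" "integrable lborel F2'"
    using c' s' by (auto intro!: integrable_lborel_bounded_support)
  \<comment> \<open>The terms with \<open>k\<close> in \<open>F1'\<close> and \<open>F2'\<close> are equal and drop out.\<close>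
  have pw: "v $ 1 * rel_velocity m v $ 1 * gx x v
      = e * (a + rel_velocity m v $ 2 * b) * g x v - e * (F1' v - F2' v)" for v
  proof -
    have "v $ 1 * (rel_velocity m v $ 1 * gx x v) =
      v $ 1 * (e * (rel_velocity m v $ 1 * b) * gv 2 x v - e * (a + rel_velocity m v $ 2 * b) * gv 1 x v)"
      using eq[of v] by simp
    then show ?thesis by (simp add: F1'_def F2'_def algebra_simps)
  qed
  have "integrable lborel (\<lambda>v. e * (a + rel_velocity m v $ 2 * b) * g x v)"
    by (rule integrable_lborel_bounded_support[where R=R]) (intro continuous_intros cont, simp add: supp)
  then have "(LINT v|lborel. v $ 1 * rel_velocity m v $ 1 * gx x v)
      = (LINT v|lborel. e * (a + rel_velocity m v $ 2 * b) * g x v)"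
    unfolding pw using int I1 I2 by simp
  moreover have "((\<lambda>x. LINT v|lborel. v $ 1 * rel_velocity m v $ 1 * g x v) has_real_derivative
     (LINT v|lborel. v $ 1 * rel_velocity m v $ 1 * gx x v)) (at x)"
  proof (rule has_real_derivative_integral_lborel[where U=UNIV and R=R])
    show "((\<lambda>x. v $ 1 * rel_velocity m v $ 1 * g x v) has_real_derivative
        v $ 1 * rel_velocity m v $ 1 * gx y v) (at y)" for y v
      by (intro DERIV_cmult dx)
    show "continuous_on UNIV (\<lambda>v. v $ 1 * rel_velocity m v $ 1 * g y v)" for y
      by (intro continuous_intros cont)
    have "continuous_on UNIV (\<lambda>z. rel_velocity m (snd z) $ 1)"
      by (rule continuous_on_compose2[OF cr]) (auto intro: continuous_intros)
    then show "continuous_on UNIV (\<lambda>(y, v). v $ 1 * rel_velocity m v $ 1 * gx y v)"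
      using cx unfolding case_prod_unfold
      by (intro continuous_on_mult) (assumption | (intro continuous_intros)[1])+
  qed (auto simp: supp sx)
  ultimately show ?thesis by simp
qed

lemma continuous_on_integral_C1:
  fixes g :: "real \<Rightarrow> real^2 \<Rightarrow> real"
  assumes C1: "C1_function (\<lambda>(x, v). g x v)" and supp: "\<And>x v. norm v > R \<Longrightarrow> g x v = 0"
  shows "continuous_on UNIV (\<lambda>x. LINT v|lborel. g x v)"
proof -
  obtain gx where
    dx: "\<And>x v. ((\<lambda>y. g y v) has_real_derivative gx x v) (at x)" and
    cx: "continuous_on UNIV (\<lambda>(x, v). gx x v)" and
    sx: "\<And>x v. norm v > R \<Longrightarrow> gx x v = 0"
    by (rule C1_partial_derivatives[of g R, OF C1]) (rule supp, assumption, rule that)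
  have "((\<lambda>x. LINT v|lborel. g x v) has_real_derivative (LINT v|lborel. gx x v)) (at x)" for x
    by (rule has_real_derivative_integral_lborel[where U=UNIV and R=R])
      (use dx cx sx supp continuous_on_section[OF C1_imp_continuous_on[OF C1]] in auto)
  then show ?thesis
    by (intro continuous_at_imp_continuous_on ballI) (rule DERIV_isCont)
qed

text \<open>The weight \<open>v\<^sub>1 v\<^sub>1/\<gamma>\<close> is positive off the axis \<open>v\<^sub>1 = 0\<close>, so \<open>g\<close> vanishes off the axis, and on
  the axis by continuity.\<close>

lemma momentum_flux_0_imp_0:
  fixes g :: "real^2 \<Rightarrow> real"
  assumes m: "m > 0" and cont: "continuous_on UNIV g" and supp: "\<And>v. norm v > R \<Longrightarrow> g v = 0"
    and nonneg: "\<And>v. g v \<ge> 0"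
    and int: "(LINT v|lborel. v $ 1 * rel_velocity m v $ 1 * g v) = 0"
  shows "g v = 0"
proof -
  have off_axis: "g w = 0" if "w $ 1 \<noteq> 0" for w
  proof -
    have "w $ 1 * rel_velocity m w $ 1 * g w = 0"
    proof (rule nonneg_continuous_integral_0_imp_0
        [where R=R and h="\<lambda>v. v $ 1 * rel_velocity m v $ 1 * g v" and v=w])
      show "continuous_on UNIV (\<lambda>v. v $ 1 * rel_velocity m v $ 1 * g v)"
        by (intro continuous_intros continuous_on_rel_velocity m cont)
      show "0 \<le> v $ 1 * rel_velocity m v $ 1 * g v" for v
        using nonneg[of v] by (simp add: rel_velocity_nth)
    qed (use supp int in auto)
    moreover have "rel_velocity m w $ 1 \<noteq> 0"
      using that energy_pos[OF m, of "w $ 1" "w $ 2"] by (simp add: rel_velocity_nth)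
    ultimately show ?thesis using that by simp
  qed
  have "((\<lambda>h. g (v + h *\<^sub>R axis 1 1)) \<longlongrightarrow> g (v + 0 *\<^sub>R axis 1 1)) (at 0)"
  proof -
    have "continuous_on UNIV (\<lambda>h. g (v + h *\<^sub>R axis 1 1))"
      by (rule continuous_on_compose2[OF cont]) (auto intro!: continuous_intros)
    then show ?thesis
      unfolding continuous_on_def by (rule bspec) simp
  qed
  moreover have "eventually (\<lambda>h. g (v + h *\<^sub>R axis 1 1) = 0) (at 0)"
  proof -
    have "eventually (\<lambda>h. h \<noteq> - v $ 1) (at (0::real))"
      by (rule eventually_neq_at_within)
    then show ?thesis
      by eventually_elim (intro off_axis, simp add: axis_def)
  qed
  ultimately have "((\<lambda>h::real. 0) \<longlongrightarrow> g v) (at 0)"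
    using tendsto_cong by fastforce
  then show ?thesis
    using tendsto_const_iff[of "at (0::real)" 0 "g v"] by simp
qed

section \<open>Supports and the steady equations\<close>

lemma compactly_supported_imp_bounded_support:
  fixes F :: "'a::real_normed_vector \<Rightarrow> 'b::zero"
  assumes "compactly_supported F"
  obtains R where "\<And>z. norm z > R \<Longrightarrow> F z = 0"
proof -
  have "bounded {z. F z \<noteq> 0}"
    using assms bounded_subset[OF compact_imp_bounded closure_subset]
    unfolding compactly_supported_def by blast
  then show ?thesis
    using that unfolding bounded_iff by (metis (mono_tags, lifting) leD mem_Collect_eq)
qed

lemma common_support_radius:
  fixes f :: "'i \<Rightarrow> 'a::real_normed_vector \<Rightarrow> 'b::real_normed_vector \<Rightarrow> real"
  assumes "finite A" and "\<And>\<alpha>. \<alpha> \<in> A \<Longrightarrow> compactly_supported (\<lambda>(x, v). f \<alpha> x v)"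
  obtains R where "\<And>\<alpha> x v. \<alpha> \<in> A \<Longrightarrow> norm x > R \<or> norm v > R \<Longrightarrow> f \<alpha> x v = 0"
proof -
  have "\<exists>r. \<forall>z. norm z > r \<longrightarrow> (case z of (x, v) \<Rightarrow> f \<alpha> x v) = 0" if "\<alpha> \<in> A" for \<alpha>
    using compactly_supported_imp_bounded_support[OF assms(2)[OF that]] by metis
  then obtain r where r: "\<And>\<alpha> x v. \<alpha> \<in> A \<Longrightarrow> norm (x, v) > r \<alpha> \<Longrightarrow> f \<alpha> x v = 0"
    by (metis case_prod_conv)
  show ?thesis
  proof (rule that[of "\<Sum>\<alpha>\<in>A. \<bar>r \<alpha>\<bar>"])
    fix \<alpha> and x :: 'a and v :: 'b
    assume *: "\<alpha> \<in> A" "norm x > (\<Sum>\<alpha>\<in>A. \<bar>r \<alpha>\<bar>) \<or> norm v > (\<Sum>\<alpha>\<in>A. \<bar>r \<alpha>\<bar>)"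
    have "r \<alpha> \<le> (\<Sum>\<alpha>\<in>A. \<bar>r \<alpha>\<bar>)"
      using member_le_sum[of \<alpha> A "\<lambda>\<alpha>. \<bar>r \<alpha>\<bar>"] * assms(1) by simp
    moreover have "norm x \<le> norm (x, v)" "norm v \<le> norm (x, v)"
      using norm_fst_le[of x v] norm_snd_le[of v x] by simp_all
    ultimately show "f \<alpha> x v = 0"
      using * by (intro r) auto
  qed
qed

text \<open>Time derivatives of constants vanish; evaluating at the interior time \<open>1\<close> makes the one-sided
  derivative an ordinary one, which is unique.\<close>

lemma steady_maxwell:
  assumes "steady_RVM_solution N m e f E2 B"
  shows "(E2 has_real_derivative 0) (at x)"
    and "(B has_real_derivative - (current_density N m e f x $ 2)) (at x)"
proof -
  have "maxwell_equations N m e (\<lambda>t. f) (\<lambda>t. E2) (\<lambda>t. B)"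
    using assms by (simp add: steady_RVM_solution_def RVM_solution_def)
  then obtain E2t E2x Bt Bx where *:
    "((\<lambda>s::real. E2 x) has_real_derivative E2t) (at 1 within {0..})"
    "(E2 has_real_derivative E2x) (at x)"
    "((\<lambda>s::real. B x) has_real_derivative Bt) (at 1 within {0..})"
    "(B has_real_derivative Bx) (at x)"
    "E2t + Bx = - (current_density N m e f x $ 2)" "Bt + E2x = 0"
    unfolding maxwell_equations_def by (metis zero_le_one)
  have "at 1 within {0..} = at (1::real)"
    by (rule at_within_interior) simp
  then have "E2t = 0" "Bt = 0"
    using DERIV_unique[OF _ DERIV_const] *(1,3) by metis+
  then show "(E2 has_real_derivative 0) (at x)"
    "(B has_real_derivative - (current_density N m e f x $ 2)) (at x)"
    using * by simp_all
qed

lemma steady_vlasov: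
  assumes "steady_RVM_solution N m e f E2 B" "\<alpha> \<in> {1..N}"
  shows "\<exists>fx fv1 fv2.
        ((\<lambda>y. f \<alpha> y v) has_real_derivative fx) (at x) \<and>
        ((\<lambda>h. f \<alpha> x (v + h *\<^sub>R axis 1 1)) has_real_derivative fv1) (at 0) \<and>
        ((\<lambda>h. f \<alpha> x (v + h *\<^sub>R axis 2 1)) has_real_derivative fv2) (at 0) \<and>
        rel_velocity (m \<alpha>) v $ 1 * fx
           + e \<alpha> * (E1_field N e f x + rel_velocity (m \<alpha>) v $ 2 * B x) * fv1
           + e \<alpha> * (E2 x - rel_velocity (m \<alpha>) v $ 1 * B x) * fv2 = 0"
proof -
  have "vlasov_equation N m e (\<lambda>t. f) (\<lambda>t. E2) (\<lambda>t. B)"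
    using assms by (simp add: steady_RVM_solution_def RVM_solution_def)
  then obtain ft fx fv1 fv2 where *:
    "((\<lambda>s::real. f \<alpha> x v) has_real_derivative ft) (at 1 within {0..})"
    "((\<lambda>y. f \<alpha> y v) has_real_derivative fx) (at x)"
    "((\<lambda>h. f \<alpha> x (v + h *\<^sub>R axis 1 1)) has_real_derivative fv1) (at 0)"
    "((\<lambda>h. f \<alpha> x (v + h *\<^sub>R axis 2 1)) has_real_derivative fv2) (at 0)"
    "ft + rel_velocity (m \<alpha>) v $ 1 * fx
           + e \<alpha> * (E1_field N e f x + rel_velocity (m \<alpha>) v $ 2 * B x) * fv1
           + e \<alpha> * (E2 x - rel_velocity (m \<alpha>) v $ 1 * B x) * fv2 = 0"
    unfolding vlasov_equation_def using assms(2) by (meson zero_le_one)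
  have "at 1 within {0..} = at (1::real)"
    by (rule at_within_interior) simp
  then have "ft = 0"
    using DERIV_unique[OF _ DERIV_const] *(1) by metis
  then show ?thesis
    using * by (intro exI[of _ fx] exI[of _ fv1] exI[of _ fv2]) simp
qed

lemma compact_support_deriv_0_imp_0:
  fixes F :: "real \<Rightarrow> real"
  assumes "compactly_supported F" "\<And>x. (F has_real_derivative 0) (at x)"
  shows "F x = 0"
proof -
  obtain R where "\<And>z. norm z > R \<Longrightarrow> F z = 0"
    using compactly_supported_imp_bounded_support[OF assms(1)] by blast
  then have "F (\<bar>R\<bar> + 1) = 0" by simp
  moreover have "F x = F (\<bar>R\<bar> + 1)"
    by (rule DERIV_isconst_all) (simp add: assms(2))
  ultimately show ?thesis by simp
qed

text \<open>With \<open>u\<close> a component of the velocity, which is at most the speed of light \<open>1\<close>, the magnetic part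
  \<open>u * B\<close> of the force cannot outweigh the electric part.\<close>

lemma force_sign:
  fixes c E B u :: real
  assumes "\<bar>B\<bar> \<le> \<bar>E\<bar>" "\<bar>u\<bar> \<le> 1" "0 \<le> c * E"
  shows "0 \<le> c * (E + u * B)"
proof -
  have "\<bar>u * B\<bar> \<le> 1 * \<bar>E\<bar>"
    unfolding abs_mult using assms by (intro mult_mono) auto
  then have "\<bar>c\<bar> * \<bar>u * B\<bar> \<le> \<bar>c\<bar> * \<bar>E\<bar>"
    by (intro mult_left_mono) auto
  then have "\<bar>c * (u * B)\<bar> \<le> \<bar>c * E\<bar>"
    by (simp add: abs_mult)
  then show ?thesis
    using assms(3) by (simp add: distrib_left)
qed

section \<open>Absence of steady states\<close>

theorem theorem1p5:
  fixes N :: nat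
    and m e :: "nat \<Rightarrow> real"
    and f :: "nat \<Rightarrow> real \<Rightarrow> real^2 \<Rightarrow> real"
    and E2 B :: "real \<Rightarrow> real"
  assumes mass_pos: "\<And>\<alpha>. \<alpha> \<in> {1..N} \<Longrightarrow> m \<alpha> > 0"
    and nonneg: "\<And>\<alpha> x v. \<alpha> \<in> {1..N} \<Longrightarrow> f \<alpha> x v \<ge> 0"
    and f_C1: "\<And>\<alpha>. \<alpha> \<in> {1..N} \<Longrightarrow> C1_function (\<lambda>(x, v). f \<alpha> x v)"
    and E2_C1: "C1_function E2"
    and B_C1: "C1_function B"
    and f_supp: "\<And>\<alpha>. \<alpha> \<in> {1..N} \<Longrightarrow> compactly_supported (\<lambda>(x, v). f \<alpha> x v)"
    and E2_supp: "compactly_supported E2"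
    and B_supp: "compactly_supported B"
    and steady: "steady_RVM_solution N m e f E2 B"
    and charge: "neutral N e f \<or> monocharge N m e"
  shows "(\<forall>\<alpha>\<in>{1..N}. \<forall>x v. f \<alpha> x v = 0) \<and> (\<forall>x. E2 x = 0) \<and> (\<forall>x. B x = 0)"
proof -
  define \<rho> where "\<rho> = charge_density N e f"
  define E where "E = E1_field N e f"
  define J where "J = (\<lambda>x. current_density N m e f x $ 2)"
  define M where "M = (LINT x|lborel. \<rho> x)"
  define P where "P = (\<lambda>\<alpha> x. LINT v|lborel. v $ 1 * rel_velocity (m \<alpha>) v $ 1 * f \<alpha> x v)"
  define D where "D = (\<lambda>\<alpha> x. LINT v|lborel. e \<alpha> * (E x + rel_velocity (m \<alpha>) v $ 2 * B x) * f \<alpha> x v)"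
  obtain R0 where R0: "\<And>\<alpha> x v. \<alpha> \<in> {1..N} \<Longrightarrow> norm x > R0 \<or> norm v > R0 \<Longrightarrow> f \<alpha> x v = 0"
    by (rule common_support_radius[of "{1..N}" f]) (use f_supp in auto)
  obtain RB where RB: "\<And>x. norm x > RB \<Longrightarrow> B x = 0"
    using compactly_supported_imp_bounded_support[OF B_supp] by blast
  define R where "R = max R0 RB"
  have supp_x: "f \<alpha> x v = 0" if "\<alpha> \<in> {1..N}" "\<bar>x\<bar> > R" for \<alpha> x v
    using R0[OF that(1)] that(2) by (simp add: R_def)
  have supp_v: "f \<alpha> x v = 0" if "\<alpha> \<in> {1..N}" "norm v > R" for \<alpha> x v
    using R0[OF that(1)] that(2) by (simp add: R_def)
  have f_cont: "continuous_on UNIV (f \<alpha> x)" if "\<alpha> \<in> {1..N}" for \<alpha> x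
    by (rule continuous_on_section[OF C1_imp_continuous_on[OF f_C1[OF that]]])
  have E2_0: "E2 x = 0" for x
    using E2_supp steady_maxwell(1)[OF steady] by (rule compact_support_deriv_0_imp_0)
  have B_deriv: "(B has_real_derivative - J x) (at x)" for x
    unfolding J_def by (rule steady_maxwell(2)[OF steady])

  have \<rho>: "\<rho> x = (\<Sum>\<alpha>=1..N. e \<alpha> * (LINT v|lborel. f \<alpha> x v))" for x
  proof -
    have "integrable lborel (\<lambda>v. e \<alpha> * f \<alpha> x v)" if "\<alpha> \<in> {1..N}" for \<alpha>
      by (rule integrable_lborel_bounded_support[where R=R])
        (use f_cont supp_v that in \<open>auto intro!: continuous_intros\<close>)
    then show ?thesis by (simp add: \<rho>_def charge_density_def)
  qed
  have J: "J x = (\<Sum>\<alpha>=1..N. e \<alpha> * (LINT v|lborel. rel_velocity (m \<alpha>) v $ 2 * f \<alpha> x v))" for x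
  proof -
    have int: "integrable lborel (\<lambda>v. (e \<alpha> * f \<alpha> x v) *\<^sub>R rel_velocity (m \<alpha>) v)" if "\<alpha> \<in> {1..N}" for \<alpha>
    proof (rule integrable_lborel_bounded_support[where R=R])
      show "continuous_on UNIV (\<lambda>v. (e \<alpha> * f \<alpha> x v) *\<^sub>R rel_velocity (m \<alpha>) v)"
        by (intro continuous_intros continuous_on_rel_velocity f_cont mass_pos that)
    qed (use supp_v that in auto)
    have "J x = (\<Sum>\<alpha>=1..N. (LINT v|lborel. (e \<alpha> * f \<alpha> x v) *\<^sub>R rel_velocity (m \<alpha>) v) $ 2)"
      using int by (simp add: J_def current_density_def sum_component)
    also have "\<dots> = (\<Sum>\<alpha>=1..N. LINT v|lborel. ((e \<alpha> * f \<alpha> x v) *\<^sub>R rel_velocity (m \<alpha>) v) $ 2)"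
      by (intro sum.cong refl integral_bounded_linear[OF bounded_linear_vec_nth, symmetric] int)
    also have "\<dots> = (\<Sum>\<alpha>=1..N. e \<alpha> * (LINT v|lborel. rel_velocity (m \<alpha>) v $ 2 * f \<alpha> x v))"
    proof (intro sum.cong refl)
      fix \<alpha>
      have "(LINT v|lborel. ((e \<alpha> * f \<alpha> x v) *\<^sub>R rel_velocity (m \<alpha>) v) $ 2)
        = (LINT v|lborel. e \<alpha> * (rel_velocity (m \<alpha>) v $ 2 * f \<alpha> x v))"
        by (simp add: ac_simps)
      then show "(LINT v|lborel. ((e \<alpha> * f \<alpha> x v) *\<^sub>R rel_velocity (m \<alpha>) v) $ 2)
        = e \<alpha> * (LINT v|lborel. rel_velocity (m \<alpha>) v $ 2 * f \<alpha> x v)"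
        by simp
    qed
    finally show ?thesis .
  qed
  have D_sum: "(\<Sum>\<alpha>=1..N. D \<alpha> x) = E x * \<rho> x + B x * J x" for x
  proof -
    have "D \<alpha> x = E x * (e \<alpha> * (LINT v|lborel. f \<alpha> x v))
        + B x * (e \<alpha> * (LINT v|lborel. rel_velocity (m \<alpha>) v $ 2 * f \<alpha> x v))"
      if \<alpha>: "\<alpha> \<in> {1..N}" for \<alpha>
    proof -
      have "integrable lborel (f \<alpha> x)"
        by (rule integrable_lborel_bounded_support[OF f_cont supp_v]) (use \<alpha> in auto)
      moreover have "integrable lborel (\<lambda>v. rel_velocity (m \<alpha>) v $ 2 * f \<alpha> x v)"
      proof (rule integrable_lborel_bounded_support[where R=R])
        show "continuous_on UNIV (\<lambda>v. rel_velocity (m \<alpha>) v $ 2 * f \<alpha> x v)"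
          by (intro continuous_intros continuous_on_rel_velocity f_cont mass_pos \<alpha>)
      qed (use supp_v \<alpha> in auto)
      moreover have "D \<alpha> x = (LINT v|lborel. (E x * e \<alpha>) * f \<alpha> x v
          + (B x * e \<alpha>) * (rel_velocity (m \<alpha>) v $ 2 * f \<alpha> x v))"
        unfolding D_def by (rule Bochner_Integration.integral_cong) (simp_all add: algebra_simps)
      ultimately show ?thesis by simp
    qed
    then show ?thesis
      by (simp add: \<rho> J sum.distrib sum_distrib_left)
  qed

  have \<rho>_cont: "continuous_on UNIV \<rho>"
    unfolding \<rho> using continuous_on_integral_C1[OF f_C1 supp_v]
    by (intro continuous_intros) auto
  have \<rho>_supp: "\<rho> x = 0" if "\<bar>x\<bar> > R" for x
  proof -
    have "f \<alpha> x = (\<lambda>v. 0)" if "\<alpha> \<in> {1..N}" for \<alpha>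
      using supp_x[OF that \<open>\<bar>x\<bar> > R\<close>] by (simp add: fun_eq_iff)
    then show ?thesis by (simp add: \<rho>)
  qed
  have E_eq: "E x = 1/2 * (LINT y:{..x}|lborel. \<rho> y) - 1/2 * (LINT y:{x..}|lborel. \<rho> y)" for x
    by (simp add: E_def E1_field_def \<rho>_def)
  have E_deriv: "(E has_real_derivative \<rho> x) (at x)" for x
    by (rule half_line_difference(1)[where R=R, OF \<rho>_cont _ E_eq M_def]) (rule \<rho>_supp)
  have E_left: "E x = - M / 2" if "x < - R" for x
    by (rule half_line_difference(2)[where R=R, OF \<rho>_cont _ E_eq M_def]) (use \<rho>_supp that in auto)
  have E_right: "E x = M / 2" if "x > R" for x
    by (rule half_line_difference(3)[where R=R, OF \<rho>_cont _ E_eq M_def]) (use \<rho>_supp that in auto)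
  have E_bound: "\<bar>E x\<bar> \<le> M / 2" if "\<And>y. \<rho> y \<ge> 0" for x
    by (rule half_line_difference(4)[where R=R, OF \<rho>_cont _ E_eq M_def]) (use \<rho>_supp that in auto)

  have P_deriv: "(P \<alpha> has_real_derivative D \<alpha> x) (at x)" if \<alpha>: "\<alpha> \<in> {1..N}" for \<alpha> x
    unfolding P_def D_def
  proof (rule momentum_flux_has_derivative[OF mass_pos[OF \<alpha>] f_C1[OF \<alpha>]])
    show "f \<alpha> x v = 0" if "norm v > R" for x v
      using \<alpha> that by (rule supp_v)
    show "\<exists>fx fv1 fv2.
        ((\<lambda>y. f \<alpha> y v) has_real_derivative fx) (at x) \<and>
        ((\<lambda>h. f \<alpha> x (v + h *\<^sub>R axis 1 1)) has_real_derivative fv1) (at 0) \<and>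
        ((\<lambda>h. f \<alpha> x (v + h *\<^sub>R axis 2 1)) has_real_derivative fv2) (at 0) \<and>
        rel_velocity (m \<alpha>) v $ 1 * fx + e \<alpha> * (E x + rel_velocity (m \<alpha>) v $ 2 * B x) * fv1
          - e \<alpha> * (rel_velocity (m \<alpha>) v $ 1 * B x) * fv2 = 0" for v
      using steady_vlasov[OF steady \<alpha>, of v x] by (simp add: E2_0 E_def)
  qed
  have P_nonneg: "P \<alpha> x \<ge> 0" if \<alpha>: "\<alpha> \<in> {1..N}" for \<alpha> x
    unfolding P_def using nonneg[OF \<alpha>] by (intro Bochner_Integration.integral_nonneg) (simp add: rel_velocity_nth)
  \<comment> \<open>The conserved quantity \<open>Q\<close>, evaluated at the point \<open>y\<close> to the left of all supports.\<close>
  have P_sum: "(\<Sum>\<alpha>=1..N. P \<alpha> x) = (E x)\<^sup>2 / 2 - (B x)\<^sup>2 / 2 - M\<^sup>2 / 8" for x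
  proof -
    define Q where "Q = (\<lambda>x. (\<Sum>\<alpha>=1..N. P \<alpha> x) - (E x)\<^sup>2 / 2 + (B x)\<^sup>2 / 2)"
    define y where "y = - \<bar>R\<bar> - 1"
    have "(Q has_real_derivative 0) (at x)" for x
    proof -
      have "(Q has_real_derivative (\<Sum>\<alpha>=1..N. D \<alpha> x) - E x * \<rho> x + B x * - J x) (at x)"
        unfolding Q_def
        by (auto intro!: derivative_eq_intros P_deriv E_deriv B_deriv)
      then show ?thesis unfolding D_sum by simp
    qed
    then have "Q x = Q y"
      by (intro DERIV_isconst_all) blast
    also have "Q y = - M\<^sup>2 / 8"
    proof -
      have "P \<alpha> y = 0" if "\<alpha> \<in> {1..N}" for \<alpha>
        unfolding P_def using supp_x[OF that, of y] by (simp add: y_def)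
      moreover have "B y = 0"
        by (rule RB) (simp add: R_def y_def)
      moreover have "E y = - M / 2"
        using E_left[of y] abs_ge_self[of R] by (simp add: y_def)
      ultimately show ?thesis
        by (simp add: Q_def power_divide)
    qed
    finally show ?thesis by (simp add: Q_def)
  qed
  have P_0_if_sum: "P \<alpha> x = 0" if "(\<Sum>\<alpha>=1..N. P \<alpha> x) \<le> 0" "\<alpha> \<in> {1..N}" for \<alpha> x
  proof -
    have "(\<Sum>\<alpha>=1..N. P \<alpha> x) = 0"
      using that(1) P_nonneg by (intro antisym sum_nonneg) auto
    then show ?thesis
      using that(2) P_nonneg sum_nonneg_eq_0_iff[of "{1..N}" "\<lambda>\<alpha>. P \<alpha> x"] by simp
  qed

  have P_0: "P \<alpha> x = 0" if \<alpha>: "\<alpha> \<in> {1..N}" for \<alpha> x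
    using charge
  proof
    assume "monocharge N m e"
    then have "\<rho> y \<ge> 0" for y
      unfolding \<rho> using nonneg by (simp add: monocharge_def)
    from E_bound[OF this, of x] have "(E x)\<^sup>2 \<le> (M / 2)\<^sup>2"
      by (intro abs_le_square_iff[THEN iffD1]) linarith
    then have "(E x)\<^sup>2 \<le> M\<^sup>2 / 4"
      by (simp add: power_divide)
    then have "(\<Sum>\<alpha>=1..N. P \<alpha> x) \<le> 0"
      unfolding P_sum using zero_le_power2[of "B x"] by linarith
    then show "P \<alpha> x = 0"
      using \<alpha> by (rule P_0_if_sum)
  next
    assume "neutral N e f"
    then have "M = 0"
      by (simp add: neutral_def M_def \<rho>_def charge_density_def)
    then have sum: "(\<Sum>\<alpha>=1..N. P \<alpha> y) = (E y)\<^sup>2 / 2 - (B y)\<^sup>2 / 2" for y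
      using P_sum by simp
    have BE: "\<bar>B y\<bar> \<le> \<bar>E y\<bar>" for y
    proof -
      have "0 \<le> (\<Sum>\<alpha>=1..N. P \<alpha> y)"
        using P_nonneg by (intro sum_nonneg) auto
      then show ?thesis
        unfolding sum by (simp add: abs_le_square_iff)
    qed
    have force: "0 \<le> c * (E y + rel_velocity (m \<alpha>) v $ 2 * B y)" if "0 \<le> c * E y" for c y v
      using BE abs_rel_velocity_le_1[OF mass_pos[OF \<alpha>]] that by (rule force_sign)
    define r where "r = \<bar>R\<bar> + \<bar>x\<bar> + 1"
    show "P \<alpha> x = 0"
    proof (rule vanishes_between_zeros[where P="P \<alpha>" and E=E and D="D \<alpha>" and c="e \<alpha>" and l="- r" and r=r])
      show "continuous_on UNIV E"
        using E_deriv by (intro continuous_at_imp_continuous_on ballI) (rule DERIV_isCont)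
      show "P \<alpha> y = 0" if "E y = 0" for y
      proof -
        have "(\<Sum>\<alpha>=1..N. P \<alpha> y) \<le> 0"
          unfolding sum by (simp add: that)
        then show ?thesis
          using \<alpha> by (rule P_0_if_sum)
      qed
      show "0 \<le> D \<alpha> y" if "0 \<le> e \<alpha> * E y" for y
        unfolding D_def
        by (intro Bochner_Integration.integral_nonneg mult_nonneg_nonneg force that nonneg \<alpha>)
      show "D \<alpha> y \<le> 0" if "e \<alpha> * E y \<le> 0" for y
      proof -
        have "0 \<le> (LINT v|lborel. - (e \<alpha> * (E y + rel_velocity (m \<alpha>) v $ 2 * B y) * f \<alpha> y v))"
        proof (rule Bochner_Integration.integral_nonneg)
          fix v
          have "0 \<le> (- e \<alpha>) * (E y + rel_velocity (m \<alpha>) v $ 2 * B y) * f \<alpha> y v"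
            using that by (intro mult_nonneg_nonneg[OF force] nonneg \<alpha>) simp
          then show "0 \<le> - (e \<alpha> * (E y + rel_velocity (m \<alpha>) v $ 2 * B y) * f \<alpha> y v)"
            by simp
        qed
        then show ?thesis by (simp add: D_def)
      qed
      have "- r < - R" "r > R"
        unfolding r_def by linarith+
      then show "E (- r) = 0" "E r = 0"
        using E_left[of "- r"] E_right[of r] \<open>M = 0\<close> by simp_all
      show "- r \<le> x" "x \<le> r"
        unfolding r_def by linarith+
    qed (use P_deriv P_nonneg \<alpha> in auto)
  qed

  have f_0: "f \<alpha> x v = 0" if \<alpha>: "\<alpha> \<in> {1..N}" for \<alpha> x v
    by (rule momentum_flux_0_imp_0[OF mass_pos[OF \<alpha>] f_cont[OF \<alpha>] supp_v[OF \<alpha>] nonneg[OF \<alpha>]])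
      (use P_0[OF \<alpha>, of x] in \<open>simp_all add: P_def\<close>)
  have "J x = 0" for x
    unfolding J using f_0 by simp
  then have "B x = 0" for x
    using B_deriv compact_support_deriv_0_imp_0[OF B_supp] by simp
  then show ?thesis
    using f_0 E2_0 by blast
qed

end
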